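(* Let $x=P(x)$ be a PPS in simple normal form with LFP $q^*$ satisfying $\mathbf{0} < q^* < \mathbf{1}$, and let $B(x)$ be the Jacobian matrix of $P(x)$. Then for all $z$ with $\mathbf{0} \leq z \leq q^*$, the spectral radius satisfies $\rho(B(z)) < 1$, and $(I-B(z))^{-1}$ exists and is entrywise nonnegative.
   Context: A PPS is a system $x_i = P_i(x)$, $i=1,\dots,n$, with each $P_i$ a polynomial with nonnegative coefficients (including constant term) summing to at most $1$; its LFP $q^*\in[0,1]^n$ is the coordinatewise least nonnegative solution. Simple normal form: each $P_i$ is either $x_jx_k$ or linear $\sum_j p_{i,j}x_j+p_{i,0}$ with nonnegative coefficients summing to at most 1. $B(x)_{i,j}=\partial P_i/\partial x_j$; $\rho$ denotes spectral radius. Inequalities between vectors are coordinatewise. *)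

theory Defs
  imports
    "HOL-Library.Poly_Mapping"
    "HOL-Analysis.Derivative"
    "Jordan_Normal_Form.Spectral_Radius"
begin

text \<open>Multivariate polynomials are finitely supported maps from monomials (finitely supported
  exponent functions) to coefficients, with the (convolution) ring structure of
  \<^theory>\<open>HOL-Library.Poly_Mapping\<close>. The variables \<open>x\<^sub>1, \<dots>, x\<^sub>n\<close> are indexed by \<open>0, \<dots>, n - 1\<close>.\<close>

type_synonym rpoly = "(nat \<Rightarrow>\<^sub>0 nat) \<Rightarrow>\<^sub>0 real"

definition pvar :: "nat \<Rightarrow> rpoly" where
  "pvar j = Poly_Mapping.single (Poly_Mapping.single j 1) 1"

definition pconst :: "real \<Rightarrow> rpoly" where
  "pconst c = Poly_Mapping.single 0 c"

definition pvars :: "rpoly \<Rightarrow> nat set" where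
  "pvars p = (\<Union>m\<in>Poly_Mapping.keys p. Poly_Mapping.keys m)"

definition peval :: "rpoly \<Rightarrow> real vec \<Rightarrow> real" where
  "peval p x = (\<Sum>m\<in>Poly_Mapping.keys p. Poly_Mapping.lookup p m *
     (\<Prod>j\<in>Poly_Mapping.keys m. (x $ j) ^ Poly_Mapping.lookup m j))"

text \<open>In a probabilistic polynomial system (PPS) the constant term counts towards the coefficient sum.\<close>

definition is_PPS :: "nat \<Rightarrow> (nat \<Rightarrow> rpoly) \<Rightarrow> bool" where
  "is_PPS n P \<longleftrightarrow> (\<forall>i<n. pvars (P i) \<subseteq> {..<n} \<and>
     (\<forall>m. 0 \<le> Poly_Mapping.lookup (P i) m) \<and>
     (\<Sum>m\<in>Poly_Mapping.keys (P i). Poly_Mapping.lookup (P i) m) \<le> 1)"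

definition is_SNF :: "nat \<Rightarrow> (nat \<Rightarrow> rpoly) \<Rightarrow> bool" where
  "is_SNF n P \<longleftrightarrow> (\<forall>i<n.
     (\<exists>j<n. \<exists>k<n. P i = pvar j * pvar k) \<or>
     (\<exists>c c0. (\<forall>j<n. 0 \<le> c j) \<and> 0 \<le> c0 \<and> (\<Sum>j<n. c j) + c0 \<le> 1 \<and>
       P i = (\<Sum>j<n. pconst (c j) * pvar j) + pconst c0))"

definition system_map :: "nat \<Rightarrow> (nat \<Rightarrow> rpoly) \<Rightarrow> real vec \<Rightarrow> real vec" where
  "system_map n P x = vec n (\<lambda>i. peval (P i) x)"

definition is_LFP :: "nat \<Rightarrow> (nat \<Rightarrow> rpoly) \<Rightarrow> real vec \<Rightarrow> bool" where
  "is_LFP n P q \<longleftrightarrow> q \<in> carrier_vec n \<and> 0\<^sub>v n \<le> q \<and> system_map n P q = q \<and>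
     (\<forall>y\<in>carrier_vec n. 0\<^sub>v n \<le> y \<longrightarrow> system_map n P y = y \<longrightarrow> q \<le> y)"

definition jacobian_mat :: "nat \<Rightarrow> (nat \<Rightarrow> rpoly) \<Rightarrow> real vec \<Rightarrow> real mat" where
  "jacobian_mat n P x =
     mat n n (\<lambda>(i, j). deriv (\<lambda>t. peval (P i) (update_vec x j t)) (x $ j))"

text \<open>The library order \<open><\<close> on vectors is \<open>\<le>\<close> without equality; the strict
  inequalities here are strict in every coordinate.\<close>

definition vec_all_less :: "real vec \<Rightarrow> real vec \<Rightarrow> bool" where
  "vec_all_less v w \<longleftrightarrow> dim_vec v = dim_vec w \<and> (\<forall>i<dim_vec v. v $ i < w $ i)"

end

theory Submission
  imports Defs
begin

text \<open>Put \<open>v = 1 - q > 0\<close>. Since \<open>P(1) \<le> 1\<close>, one has \<open>B(q) v \<le> v\<close>, with strict inequality in every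
  quadratic row and in every affine row whose coefficients sum to less than \<open>1\<close>. If
  \<open>y \<le> B(z) y\<close> and \<open>y\<close> had a positive entry, the indices maximising \<open>y\<^sub>i / v\<^sub>i\<close> would therefore form
  a set of affine rows with coefficient sum \<open>1\<close> that refer only to one another. On such a set, the
  indices minimising \<open>q\<close> again refer only to one another and have no constant term, so \<open>q\<close> could be
  lowered to \<open>0\<close> there, contradicting minimality. Hence \<open>y \<le> B(z) y\<close> forces \<open>y \<le> 0\<close>. Taking for \<open>y\<close>
  the moduli of an eigenvector bounds the spectral radius; taking the negated columns of
  \<open>(I - B(z))\<^sup>-\<^sup>1\<close> shows that the inverse is nonnegative.\<close>

section \<open>Evaluation of polynomials\<close>

text \<open>Monomials outside the support have coefficient 0. Padding lets polynomials with
  different supports be summed over one index set, which gives additivity of \<open>peval\<close>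
  even when terms cancel.\<close>

lemma peval_eq_sum:
  assumes "finite A" "Poly_Mapping.keys p \<subseteq> A"
  shows "peval p x = (\<Sum>m\<in>A. Poly_Mapping.lookup p m *
     (\<Prod>j\<in>Poly_Mapping.keys m. (x $ j) ^ Poly_Mapping.lookup m j))"
  unfolding peval_def using assms by (intro sum.mono_neutral_left) (auto simp: in_keys_iff)

lemma peval_add: "peval (p + r) x = peval p x + peval r x"
proof -
  let ?A = "Poly_Mapping.keys p \<union> Poly_Mapping.keys r"
  have "Poly_Mapping.keys (p + r) \<subseteq> ?A" by (rule keys_add)
  then show ?thesis
    by (simp add: peval_eq_sum[of ?A] lookup_add distrib_right sum.distrib)
qed

lemma peval_sum: "peval (\<Sum>i\<in>I. f i) x = (\<Sum>i\<in>I. peval (f i) x)"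
proof (induction I rule: infinite_finite_induct)
  case (insert i I)
  then show ?case by (simp add: peval_add)
qed (simp_all add: peval_def)

lemma peval_single:
  "peval (Poly_Mapping.single m c) x =
    c * (\<Prod>j\<in>Poly_Mapping.keys m. (x $ j) ^ Poly_Mapping.lookup m j)"
  by (simp add: peval_def)

lemma peval_pvar_mult: "peval (pvar j * pvar k) x = x $ j * x $ k"
proof -
  let ?m = "Poly_Mapping.single j 1 + Poly_Mapping.single k (1 :: nat)"
  \<comment> \<open>For \<open>j = k\<close> this set is a singleton with exponent 2, hence the case
    split at the end.\<close>
  have keys: "Poly_Mapping.keys ?m = {j, k}"
    by (auto simp: in_keys_iff lookup_add lookup_single when_def split: if_splits)
  have "peval (pvar j * pvar k) x = (\<Prod>l\<in>{j, k}. (x $ l) ^ Poly_Mapping.lookup ?m l)"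
    using peval_single[of ?m 1 x] unfolding keys by (simp add: pvar_def mult_single)
  also have "\<dots> = x $ j * x $ k"
    by (cases "j = k") (auto simp: lookup_add lookup_single when_def power2_eq_square)
  finally show ?thesis .
qed

lemma peval_affine:
  "peval ((\<Sum>j<n. pconst (c j) * pvar j) + pconst c0) x = (\<Sum>j<n. c j * x $ j) + c0"
  by (simp add: peval_add peval_sum pconst_def pvar_def mult_single peval_single)

section \<open>Monotonicity and pre-fixed points\<close>

lemma peval_mono:
  fixes x y :: "real vec"
  assumes "is_PPS n P" "i < n" "\<And>j. j < n \<Longrightarrow> 0 \<le> x $ j" "\<And>j. j < n \<Longrightarrow> x $ j \<le> y $ j"
  shows "peval (P i) x \<le> peval (P i) y"
  unfolding peval_def
proof (intro sum_mono mult_left_mono prod_mono conjI)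
  fix m j assume "m \<in> Poly_Mapping.keys (P i)" "j \<in> Poly_Mapping.keys m"
  then have "j < n" using assms(1,2) unfolding is_PPS_def pvars_def by blast
  then show "0 \<le> (x $ j) ^ Poly_Mapping.lookup m j"
    and "(x $ j) ^ Poly_Mapping.lookup m j \<le> (y $ j) ^ Poly_Mapping.lookup m j"
    using assms(3,4) by (simp_all add: power_mono)
qed (use assms(1,2) in \<open>auto simp: is_PPS_def\<close>)

lemma peval_nonneg:
  fixes x :: "real vec"
  assumes "is_PPS n P" "i < n" "\<And>j. j < n \<Longrightarrow> 0 \<le> x $ j"
  shows "0 \<le> peval (P i) x"
  unfolding peval_def
proof (intro sum_nonneg mult_nonneg_nonneg prod_nonneg ballI)
  fix m j assume "m \<in> Poly_Mapping.keys (P i)" "j \<in> Poly_Mapping.keys m"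
  then have "j < n" using assms(1,2) unfolding is_PPS_def pvars_def by blast
  then show "0 \<le> (x $ j) ^ Poly_Mapping.lookup m j" using assms(3) by simp
qed (use assms(1,2) in \<open>auto simp: is_PPS_def\<close>)

text \<open>As in the Knaster--Tarski theorem, the infimum of the pre-fixed points is a fixed point.\<close>

lemma LFP_le_prefixpoint:
  fixes q y :: "real vec"
  assumes "is_PPS n P" "is_LFP n P q"
    and y0: "\<And>j. j < n \<Longrightarrow> 0 \<le> y $ j" and yP: "\<And>j. j < n \<Longrightarrow> peval (P j) y \<le> y $ j"
    and "i < n"
  shows "q $ i \<le> y $ i"
proof -
  define D where "D = {x :: real vec. \<forall>j<n. 0 \<le> x $ j \<and> peval (P j) x \<le> x $ j}"
  define r where "r = vec n (\<lambda>j. INF x\<in>D. x $ j)"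
  have yD: "y \<in> D" using y0 yP by (simp add: D_def)
  \<comment> \<open>Real infima behave well only for nonempty sets bounded below: \<open>yD\<close>
    gives the first, the bound 0 the second.\<close>
  have bdd: "bdd_below ((\<lambda>x. x $ j) ` D)" if "j < n" for j
    using that by (intro bdd_belowI[of _ 0]) (auto simp: D_def)
  have r_le: "r $ j \<le> x $ j" if "j < n" "x \<in> D" for j x
    using that bdd by (auto simp: r_def intro: cINF_lower)
  have r_ge: "a \<le> r $ j" if "j < n" "\<And>x. x \<in> D \<Longrightarrow> a \<le> x $ j" for j a
    using that yD by (auto simp: r_def intro!: cINF_greatest)
  have r0: "0 \<le> r $ j" if "j < n" for j
    using that by (intro r_ge) (auto simp: D_def)
  have Pr: "peval (P j) r \<le> r $ j" if j: "j < n" for j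
  proof (rule r_ge[OF j])
    fix x assume x: "x \<in> D"
    have "peval (P j) r \<le> peval (P j) x"
      by (rule peval_mono[OF assms(1) j]) (auto simp: r0 r_le x)
    also have "\<dots> \<le> x $ j" using x j by (simp add: D_def)
    finally show "peval (P j) r \<le> x $ j" .
  qed
  \<comment> \<open>By monotonicity the image of \<open>r\<close> is again a pre-fixed point, so
    \<open>r\<close> lies below it; together with \<open>Pr\<close> this makes \<open>r\<close> a
    fixed point.\<close>
  define s where "s = system_map n P r"
  have s: "s $ j = peval (P j) r" if "j < n" for j using that by (simp add: s_def system_map_def)
  have "s \<in> D"
    unfolding D_def using s Pr r0 peval_nonneg[OF assms(1)] peval_mono[OF assms(1)] by auto
  then have "r $ j \<le> peval (P j) r" if "j < n" for j using r_le[OF that] s[OF that] by fastforce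
  with Pr have "system_map n P r = r"
    by (intro eq_vecI) (auto simp: system_map_def r_def intro: order.antisym)
  moreover have "0\<^sub>v n \<le> r" "r \<in> carrier_vec n" using r0 by (auto simp: less_eq_vec_def r_def)
  ultimately have "q \<le> r" using assms(2) by (simp add: is_LFP_def)
  then have "q $ i \<le> r $ i" using \<open>i < n\<close> by (simp add: less_eq_vec_def r_def)
  also have "\<dots> \<le> y $ i" using r_le[OF \<open>i < n\<close> yD] .
  finally show ?thesis .
qed

section \<open>Rows of the Jacobian matrix\<close>

lemma jacobian_mat_carrier: "jacobian_mat n P z \<in> carrier_mat n n"
  by (simp add: jacobian_mat_def)

lemma update_vec_index:
  "l < dim_vec z \<Longrightarrow> update_vec z j t $ l = (if l = j then t else z $ l)"
  by (simp add: update_vec_def)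

text \<open>Pairing the row with an arbitrary \<open>w\<close> gives one formula that also covers
  \<open>j = k\<close>, where the only nonzero entry can be twice \<open>z $ j\<close>.\<close>

lemma jacobian_row_quadratic:
  assumes "i < n" "j < n" "k < n" "P i = pvar j * pvar k" "z \<in> carrier_vec n"
  shows "(\<Sum>l<n. jacobian_mat n P z $$ (i, l) * w l) = z $ k * w j + z $ j * w k"
proof -
  have "jacobian_mat n P z $$ (i, l) =
      (if l = j then z $ k else 0) + (if l = k then z $ j else 0)" if "l < n" for l
  proof -
    have eq: "(\<lambda>t. peval (P i) (update_vec z l t)) =
        (\<lambda>t. (if j = l then t else z $ j) * (if k = l then t else z $ k))"
      using assms by (auto simp: peval_pvar_mult update_vec_index)
    have "((\<lambda>t. (if j = l then t else z $ j) * (if k = l then t else z $ k)) has_field_derivative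
        (if l = j then z $ k else 0) + (if l = k then z $ j else 0)) (at (z $ l))"
      by (cases "j = l"; cases "k = l") (auto intro!: derivative_eq_intros)
    then have "deriv (\<lambda>t. peval (P i) (update_vec z l t)) (z $ l) =
        (if l = j then z $ k else 0) + (if l = k then z $ j else 0)"
      unfolding eq by (rule DERIV_imp_deriv)
    then show ?thesis using assms(1) that by (simp add: jacobian_mat_def)
  qed
  then have "(\<Sum>l<n. jacobian_mat n P z $$ (i, l) * w l) =
      (\<Sum>l<n. (if l = j then z $ k * w l else 0) + (if l = k then z $ j * w l else 0))"
    by (intro sum.cong) (auto simp: distrib_right)
  then show ?thesis using assms by (simp add: sum.distrib)
qed

lemma jacobian_row_affine:
  assumes "i < n" "P i = (\<Sum>j<n. pconst (c j) * pvar j) + pconst c0" "z \<in> carrier_vec n"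
  shows "(\<Sum>l<n. jacobian_mat n P z $$ (i, l) * w l) = (\<Sum>l<n. c l * w l)"
proof (intro sum.cong refl)
  fix l assume "l \<in> {..<n}"
  then have l: "l < n" by simp
  have eq: "(\<lambda>t. peval (P i) (update_vec z l t)) =
      (\<lambda>t. (\<Sum>j<n. c j * (if j = l then t else z $ j)) + c0)"
    using assms by (auto simp: peval_affine update_vec_index intro!: sum.cong)
  have "((\<lambda>t. c j * (if j = l then t else z $ j)) has_field_derivative
      (if j = l then c l else 0)) (at (z $ l))" for j
    by (cases "j = l") (auto intro!: derivative_eq_intros)
  then have "((\<lambda>t. (\<Sum>j<n. c j * (if j = l then t else z $ j)) + c0) has_field_derivative
      (\<Sum>j<n. if j = l then c l else 0) + 0) (at (z $ l))"
    by (intro DERIV_add DERIV_sum DERIV_const)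
  then have "deriv (\<lambda>t. peval (P i) (update_vec z l t)) (z $ l) = c l"
    unfolding eq using l by (simp add: DERIV_imp_deriv)
  then show "jacobian_mat n P z $$ (i, l) * w l = c l * w l"
    using assms(1) l by (simp add: jacobian_mat_def)
qed

lemma SNF_cases:
  assumes "is_SNF n P" "i < n"
  obtains (quadratic) j k where "j < n" "k < n" "P i = pvar j * pvar k"
  | (affine) c c0 where "\<And>j. j < n \<Longrightarrow> 0 \<le> c j" "0 \<le> c0" "(\<Sum>j<n. c j) + c0 \<le> 1"
      "P i = (\<Sum>j<n. pconst (c j) * pvar j) + pconst c0"
proof -
  from assms have "(\<exists>j<n. \<exists>k<n. P i = pvar j * pvar k) \<or>
     (\<exists>c c0. (\<forall>j<n. 0 \<le> c j) \<and> 0 \<le> c0 \<and> (\<Sum>j<n. c j) + c0 \<le> 1 \<and>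
       P i = (\<Sum>j<n. pconst (c j) * pvar j) + pconst c0)"
    by (simp add: is_SNF_def)
  then show thesis
  proof
    assume "\<exists>j<n. \<exists>k<n. P i = pvar j * pvar k"
    then show thesis using quadratic by blast
  next
    assume "\<exists>c c0. (\<forall>j<n. 0 \<le> c j) \<and> 0 \<le> c0 \<and> (\<Sum>j<n. c j) + c0 \<le> 1 \<and>
       P i = (\<Sum>j<n. pconst (c j) * pvar j) + pconst c0"
    then show thesis using affine by blast
  qed
qed

lemma jacobian_nonneg:
  fixes z :: "real vec"
  assumes "is_SNF n P" "i < n" "l < n" "z \<in> carrier_vec n" "\<And>j. j < n \<Longrightarrow> 0 \<le> z $ j"
  shows "0 \<le> jacobian_mat n P z $$ (i, l)"
proof -
  \<comment> \<open>Pairing with the indicator of \<open>l\<close> isolates a single entry, so both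
    row formulas apply.\<close>
  define w where "w = (\<lambda>m. if m = l then 1 else 0 :: real)"
  have "jacobian_mat n P z $$ (i, l) = (\<Sum>m<n. jacobian_mat n P z $$ (i, m) * w m)"
    using assms(3) by (simp add: w_def if_distrib cong: if_cong)
  also have "0 \<le> \<dots>"
    using assms(1,2)
  proof (cases rule: SNF_cases)
    case (quadratic j k)
    show ?thesis
      unfolding jacobian_row_quadratic[where P = P, OF assms(2) quadratic assms(4)]
      using quadratic assms(5) by (simp add: w_def)
  next
    case (affine c c0)
    show ?thesis
      unfolding jacobian_row_affine[where P = P, OF assms(2) affine(4) assms(4)]
      using affine(1) by (auto simp: w_def intro!: sum_nonneg)
  qed
  finally show ?thesis .
qed

section \<open>Minimum and maximum principles\<close>

lemma LFP_peval:
  assumes "is_LFP n P q" "i < n"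
  shows "peval (P i) q = q $ i"
proof -
  have "system_map n P q $ i = q $ i" using assms(1) by (simp add: is_LFP_def)
  then show ?thesis using assms(2) by (simp add: system_map_def)
qed

text \<open>A minimum principle: each row in \<open>M\<close> averages entries of \<open>q\<close>
  inside \<open>M\<close> and, with weight \<open>c0\<close>, the value 1. A minimal entry can
  therefore average only minimal entries.\<close>

lemma no_closed_stochastic_set:
  fixes q :: "real vec"
  assumes "is_PPS n P" "is_LFP n P q"
    and q: "\<And>i. i < n \<Longrightarrow> 0 < q $ i" "\<And>i. i < n \<Longrightarrow> q $ i < 1"
    and M: "M \<subseteq> {..<n}" "M \<noteq> {}"
    and affine: "\<And>i. i \<in> M \<Longrightarrow> \<exists>c c0. (\<forall>j<n. 0 \<le> c j) \<and> 0 \<le> c0 \<and> (\<Sum>j<n. c j) + c0 = 1 \<and>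
       P i = (\<Sum>j<n. pconst (c j) * pvar j) + pconst c0 \<and> (\<forall>j<n. 0 < c j \<longrightarrow> j \<in> M)"
  shows False
proof -
  have fin: "finite M" using M(1) finite_subset by blast
  define m where "m = Min ((\<lambda>i. q $ i) ` M)"
  have m_le: "m \<le> q $ i" if "i \<in> M" for i using that fin by (simp add: m_def)
  obtain i0 where i0: "i0 \<in> M" "q $ i0 = m"
    using Min_in[of "(\<lambda>i. q $ i) ` M"] fin M(2) unfolding m_def by fastforce
  have m1: "m < 1" using i0 q(2) M(1) by auto
  note fixp = LFP_peval[OF assms(2)]
  \<comment> \<open>All minimal entries over \<open>M\<close> are lowered to 0 at once;
    \<open>y\<close> turns out to be a pre-fixed point, yet it is smaller than \<open>q\<close> at
    \<open>i0\<close>.\<close>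
  define y where "y = vec n (\<lambda>i. if i \<in> M \<and> q $ i = m then 0 else q $ i)"
  have y0: "0 \<le> y $ j" and yq: "y $ j \<le> q $ j" if "j < n" for j
    using q(1)[OF that] that by (auto simp: y_def)
  have "peval (P i) y \<le> y $ i" if "i < n" for i
  proof (cases "i \<in> M \<and> q $ i = m")
    case True
    then obtain c c0 where c: "\<And>j. j < n \<Longrightarrow> 0 \<le> c j" "0 \<le> c0" "(\<Sum>j<n. c j) + c0 = 1"
      "P i = (\<Sum>j<n. pconst (c j) * pvar j) + pconst c0" "\<And>j. j < n \<Longrightarrow> 0 < c j \<Longrightarrow> j \<in> M"
      using affine by blast
    \<comment> \<open>Positive weight puts \<open>j\<close> in \<open>M\<close>, where
      \<open>m\<close> is a lower bound; otherwise the weight is 0.\<close>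
    have nonneg: "0 \<le> c j * (q $ j - m)" if "j < n" for j
      using c(1)[OF that] c(5)[OF that] m_le[of j] by (cases "c j = 0") auto
    \<comment> \<open>The weights, \<open>c0\<close> included, sum to 1 and row \<open>i\<close> has
      value \<open>m\<close> at \<open>q\<close>, so the weighted deviations from \<open>m\<close>
      sum to 0. Being nonnegative, they vanish separately.\<close>
    have "(\<Sum>j<n. c j * (q $ j - m)) + c0 * (1 - m) =
        ((\<Sum>j<n. c j * q $ j) + c0) - m * ((\<Sum>j<n. c j) + c0)"
      by (simp add: algebra_simps sum_subtractf sum_distrib_left)
    also have "\<dots> = 0"
      using fixp[OF \<open>i < n\<close>] True unfolding c(3,4) peval_affine by simp
    finally have sum0: "(\<Sum>j<n. c j * (q $ j - m)) + c0 * (1 - m) = 0" .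
    have ge: "0 \<le> (\<Sum>j<n. c j * (q $ j - m))" "0 \<le> c0 * (1 - m)"
      using nonneg c(2) m1 by (auto intro: sum_nonneg)
    then have "c0 * (1 - m) = 0" and S0: "(\<Sum>j<n. c j * (q $ j - m)) = 0"
      using sum0 by linarith+
    then have "c0 = 0" using m1 by simp
    have "c j * y $ j = 0" if "j < n" for j
    proof -
      have "c j * (q $ j - m) = 0"
        using nonneg that by (intro sum_nonneg_0[OF _ _ S0]) auto
      then show ?thesis using c(1)[OF that] c(5)[OF that] that by (cases "c j = 0") (auto simp: y_def)
    qed
    then have "(\<Sum>j<n. c j * y $ j) = 0" by (intro sum.neutral) auto
    then have "peval (P i) y = 0" unfolding c(4) peval_affine by (simp only: \<open>c0 = 0\<close>)
    then show ?thesis using y0[OF that] by simp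
  next
    case False
    have "peval (P i) y \<le> peval (P i) q"
      by (rule peval_mono[OF assms(1) that]) (auto simp: y0 yq)
    also have "\<dots> = y $ i" using False that fixp by (auto simp: y_def)
    finally show ?thesis .
  qed
  then have "q $ i0 \<le> y $ i0"
    using LFP_le_prefixpoint[OF assms(1,2) y0, of i0] i0 M(1) by auto
  moreover have "y $ i0 = 0" "0 < q $ i0" using i0 M(1) q(1) by (auto simp: y_def)
  ultimately show False by simp
qed

text \<open>The sign of \<open>y\<close> is left free so that the principle serves moduli of
  eigenvectors, kernel vectors and negated columns of the inverse alike.\<close>

lemma jacobian_maximum_principle:
  fixes q z :: "real vec"
  assumes "is_PPS n P" "is_SNF n P" "is_LFP n P q"
    and q: "\<And>i. i < n \<Longrightarrow> 0 < q $ i" "\<And>i. i < n \<Longrightarrow> q $ i < 1"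
    and z: "z \<in> carrier_vec n" "\<And>i. i < n \<Longrightarrow> 0 \<le> z $ i" "\<And>i. i < n \<Longrightarrow> z $ i \<le> q $ i"
    and y: "\<And>i. i < n \<Longrightarrow> y i \<le> (\<Sum>j<n. jacobian_mat n P z $$ (i, j) * y j)"
    and "i < n"
  shows "y i \<le> 0"
proof (rule ccontr)
  assume "\<not> y i \<le> 0"
  define v where "v = (\<lambda>i. 1 - q $ i)"
  have v: "0 < v j" if "j < n" for j using q(2)[OF that] by (simp add: v_def)
  define r where "r = Max ((\<lambda>j. y j / v j) ` {..<n})"
  define M where "M = {j. j < n \<and> y j = r * v j}"
  have r_ge: "y j / v j \<le> r" if "j < n" for j using that by (simp add: r_def)
  have "0 < y i / v i" using \<open>\<not> y i \<le> 0\<close> v \<open>i < n\<close> by simp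
  then have "0 < r" using r_ge[OF \<open>i < n\<close>] by linarith
  have yr: "y j \<le> r * v j" if "j < n" for j
    using r_ge[OF that] v[OF that] by (simp add: pos_divide_le_eq)
  have "r \<in> (\<lambda>j. y j / v j) ` {..<n}" unfolding r_def using \<open>i < n\<close> by (intro Max_in) auto
  then obtain i0 where "i0 < n" "r = y i0 / v i0" by auto
  then have "i0 \<in> M" using v[of i0] by (simp add: M_def)
  note fixp = LFP_peval[OF assms(3)]
  show False
  proof (rule no_closed_stochastic_set[OF assms(1,3) q, of M])
    show "M \<subseteq> {..<n}" "M \<noteq> {}" using \<open>i0 \<in> M\<close> by (auto simp: M_def)
    fix i assume "i \<in> M"
    then have i: "i < n" and yi: "y i = r * v i" by (auto simp: M_def)
    from assms(2) i
    show "\<exists>c c0. (\<forall>j<n. 0 \<le> c j) \<and> 0 \<le> c0 \<and> (\<Sum>j<n. c j) + c0 = 1 \<and>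
       P i = (\<Sum>j<n. pconst (c j) * pvar j) + pconst c0 \<and> (\<forall>j<n. 0 < c j \<longrightarrow> j \<in> M)"
    proof (cases rule: SNF_cases)
      case (quadratic j k)
      \<comment> \<open>The chain refutes this case. Entries of \<open>y\<close> may be negative, so
        \<open>y\<close> is first replaced by \<open>r * v\<close>, using that \<open>z\<close> is
        nonnegative; only then can \<open>z\<close> be raised to \<open>q\<close>.\<close>
      have "y i \<le> z $ k * y j + z $ j * y k"
        using y[OF i] unfolding jacobian_row_quadratic[where P = P, OF i quadratic z(1)] .
      also have "\<dots> \<le> z $ k * (r * v j) + z $ j * (r * v k)"
        using quadratic z(2) yr by (intro add_mono mult_left_mono) auto
      also have "\<dots> \<le> q $ k * (r * v j) + q $ j * (r * v k)"
        using quadratic z(3) v \<open>0 < r\<close>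
        by (intro add_mono mult_right_mono) (auto intro: less_imp_le)
      \<comment> \<open>Since \<open>q $ i = q $ j * q $ k\<close>, one has
        \<open>q $ k * v j + q $ j * v k = v i - v j * v k\<close>; the product
        \<open>v j * v k\<close> makes the bound strict.\<close>
      also have "\<dots> = r * (v i - v j * v k)"
        using fixp[OF i] unfolding quadratic(3) peval_pvar_mult
        by (simp add: v_def algebra_simps)
      also have "\<dots> < r * v i" using \<open>0 < r\<close> v quadratic by simp
      finally show ?thesis using yi by simp
    next
      case (affine c c0)
      have qi: "q $ i = (\<Sum>l<n. c l * q $ l) + c0"
        using fixp[OF i] unfolding affine(4) peval_affine by simp
      \<comment> \<open>The amount by which the row applied to \<open>v\<close> falls short of
        \<open>v i\<close> is 1 minus the coefficient sum.\<close>
      have cv: "(\<Sum>l<n. c l * v l) = v i - (1 - ((\<Sum>l<n. c l) + c0))"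
        by (simp add: v_def qi right_diff_distrib sum_subtractf)
      have "r * v i \<le> (\<Sum>l<n. c l * y l)"
        using y[OF i] yi unfolding jacobian_row_affine[where P = P, OF i affine(4) z(1)] by simp
      moreover have "(\<Sum>l<n. c l * (r * v l - y l)) = r * (\<Sum>l<n. c l * v l) - (\<Sum>l<n. c l * y l)"
        by (simp add: algebra_simps sum_subtractf sum_distrib_left)
      \<comment> \<open>A sum of nonnegative terms lies below a nonpositive number, so both are 0:
        the coefficients sum to 1, and positive weight forces \<open>y l = r * v l\<close>.\<close>
      ultimately have le: "(\<Sum>l<n. c l * (r * v l - y l)) \<le> - (r * (1 - ((\<Sum>l<n. c l) + c0)))"
        unfolding cv by (simp add: algebra_simps)
      have nonneg: "0 \<le> c l * (r * v l - y l)" if "l < n" for l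
        using affine(1)[OF that] yr[OF that] by simp
      then have ge: "0 \<le> (\<Sum>l<n. c l * (r * v l - y l))" by (auto intro: sum_nonneg)
      have "0 \<le> r * (1 - ((\<Sum>l<n. c l) + c0))" using \<open>0 < r\<close> affine(3) by simp
      with le ge have "r * (1 - ((\<Sum>l<n. c l) + c0)) = 0" "(\<Sum>l<n. c l * (r * v l - y l)) = 0"
        by linarith+
      then have one: "(\<Sum>l<n. c l) + c0 = 1" and S0: "(\<Sum>l<n. c l * (r * v l - y l)) = 0"
        using \<open>0 < r\<close> by auto
      have "j \<in> M" if "j < n" "0 < c j" for j
      proof -
        have "c j * (r * v j - y j) = 0"
          using nonneg that by (intro sum_nonneg_0[OF _ _ S0]) auto
        then show ?thesis using that by (simp add: M_def)
      qed
      then show ?thesis using affine one by blast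
    qed
  qed
qed

section \<open>Spectral radius and nonnegative inverse\<close>

lemma mult_mat_vec_index_sum:
  assumes "A \<in> carrier_mat n n" "x \<in> carrier_vec n" "i < n"
  shows "(A *\<^sub>v x) $ i = (\<Sum>j<n. A $$ (i, j) * x $ j)"
  using assms by (auto simp: scalar_prod_def atLeast0LessThan intro!: sum.cong)

theorem theorem3p6:
  fixes n :: nat and P :: "nat \<Rightarrow> rpoly" and q z :: "real vec"
  assumes "0 < n"
    and "is_PPS n P" and "is_SNF n P"
    and "is_LFP n P q"
    and "vec_all_less (0\<^sub>v n) q" and "vec_all_less q (vec n (\<lambda>_. 1))"
    and "0\<^sub>v n \<le> z" and "z \<le> q"
  shows "spectral_radius (map_mat complex_of_real (jacobian_mat n P z)) < 1 \<and>
    (\<exists>C\<in>carrier_mat n n.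
       inverts_mat (1\<^sub>m n - jacobian_mat n P z) C \<and>
       inverts_mat C (1\<^sub>m n - jacobian_mat n P z) \<and>
       0\<^sub>m n n \<le> C)"
proof -
  define A where "A = jacobian_mat n P z"
  have A: "A \<in> carrier_mat n n" by (simp add: A_def jacobian_mat_carrier)
  have qdim: "dim_vec q = n" using assms(4) by (auto simp: is_LFP_def)
  have q: "0 < q $ i" "q $ i < 1" if "i < n" for i
    using assms(5,6) that qdim by (auto simp: vec_all_less_def)
  have z: "z \<in> carrier_vec n" using assms(7) by (auto simp: less_eq_vec_def intro: carrier_vecI)
  have z0: "0 \<le> z $ i" and zq: "z $ i \<le> q $ i" if "i < n" for i
    using assms(7,8) that z qdim by (auto simp: less_eq_vec_def)
  have A0: "0 \<le> A $$ (i, j)" if "i < n" "j < n" for i j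
    unfolding A_def by (rule jacobian_nonneg[OF assms(3) that z z0])
  have max: "y i \<le> 0" if "\<And>i. i < n \<Longrightarrow> y i \<le> (\<Sum>j<n. A $$ (i, j) * y j)" "i < n" for y i
    by (rule jacobian_maximum_principle[OF assms(2-4) q z z0 zq that(1)[unfolded A_def] that(2)])

  let ?A = "map_mat complex_of_real A"
  have cA: "?A \<in> carrier_mat n n" using A by simp
  have eig: "norm l < 1" if "eigenvalue ?A l" for l
  proof (rule ccontr)
    assume "\<not> norm l < 1"
    from that obtain x where x: "x \<in> carrier_vec n" "x \<noteq> 0\<^sub>v n" "?A *\<^sub>v x = l \<cdot>\<^sub>v x"
      using cA by (auto simp: eigenvalue_def eigenvector_def)
    \<comment> \<open>With \<open>norm l\<close> at least 1, the triangle inequality and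
      nonnegativity of \<open>A\<close> show that the moduli of \<open>x\<close> satisfy the
      hypothesis of \<open>max\<close>.\<close>
    have "norm (x $ i) \<le> (\<Sum>j<n. A $$ (i, j) * norm (x $ j))" if i: "i < n" for i
    proof -
      have "norm (x $ i) \<le> norm l * norm (x $ i)"
        using \<open>\<not> norm l < 1\<close> by (simp add: mult_le_cancel_right1)
      also have "\<dots> = norm ((?A *\<^sub>v x) $ i)" using x i by (simp add: norm_mult)
      also have "\<dots> = norm (\<Sum>j<n. ?A $$ (i, j) * x $ j)"
        unfolding mult_mat_vec_index_sum[OF cA x(1) i] ..
      also have "\<dots> \<le> (\<Sum>j<n. norm (?A $$ (i, j) * x $ j))" by (rule norm_sum)
      also have "\<dots> = (\<Sum>j<n. A $$ (i, j) * norm (x $ j))"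
        using A A0 i by (intro sum.cong) (auto simp: norm_mult)
      finally show ?thesis .
    qed
    then have "norm (x $ i) \<le> 0" if "i < n" for i using max[of "\<lambda>i. norm (x $ i)"] that by blast
    then have "x = 0\<^sub>v n" using x(1) by (intro eq_vecI) auto
    with x(2) show False by simp
  qed
  \<comment> \<open>As \<open>n\<close> is positive, the spectral radius is the modulus of some
    eigenvalue, so the strict bound carries over.\<close>
  have rho: "spectral_radius ?A < 1"
    using spectral_radius_mem_max(1)[OF cA assms(1)] eig by (auto simp: spectrum_def)

  let ?D = "1\<^sub>m n - A"
  have D: "?D \<in> carrier_mat n n" using A by (rule minus_carrier_mat)
  have D_row: "(?D *\<^sub>v x) $ i = x $ i - (\<Sum>j<n. A $$ (i, j) * x $ j)"
    if "x \<in> carrier_vec n" "i < n" for x :: "real vec" and i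
    using that A by (simp add: minus_mult_distrib_mat_vec[of _ n n] mult_mat_vec_index_sum[OF A]
      del: index_mult_mat_vec)
  \<comment> \<open>If \<open>x - A x\<close> is nonnegative, then \<open>-x\<close> is at most
    \<open>A (-x)\<close>, and \<open>max\<close> applies to \<open>-x\<close>.\<close>
  have nonneg: "0 \<le> x $ i" if x: "x \<in> carrier_vec n" "\<And>i. i < n \<Longrightarrow> 0 \<le> (?D *\<^sub>v x) $ i" "i < n"
    for x :: "real vec" and i
  proof -
    have "- x $ j \<le> (\<Sum>k<n. A $$ (j, k) * - x $ k)" if "j < n" for j
      using x(2)[OF that] D_row[OF x(1) that] by (simp add: sum_negf)
    then show ?thesis using max[of "\<lambda>j. - x $ j" i] x(3) by simp
  qed
  have "det ?D \<noteq> 0"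
  proof
    assume "det ?D = 0"
    then obtain x where x: "x \<in> carrier_vec n" "x \<noteq> 0\<^sub>v n" "?D *\<^sub>v x = 0\<^sub>v n"
      using det_0_iff_vec_prod_zero[OF D] by blast
    have "x $ i = 0" if i: "i < n" for i
    proof -
      \<comment> \<open>A kernel vector is fixed by \<open>A\<close>, so the principle bounds it
        from both sides.\<close>
      have row: "x $ j = (\<Sum>k<n. A $$ (j, k) * x $ k)" if "j < n" for j
        using D_row[OF x(1) that] x(3) that by simp
      have "0 \<le> x $ i" by (rule nonneg[OF x(1) _ i]) (simp add: x(3))
      moreover have "x $ i \<le> 0" by (rule max[of "\<lambda>j. x $ j", OF eq_refl[OF row] i])
      ultimately show ?thesis by simp
    qed
    then have "x = 0\<^sub>v n" using x(1) by (intro eq_vecI) auto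
    with x(2) show False by simp
  qed
  \<comment> \<open>The \<open>()\<close> fills the extension slot of the matrix ring record; units
    of this ring have two-sided inverses.\<close>
  then obtain C where C: "C \<in> carrier_mat n n" "?D * C = 1\<^sub>m n" "C * ?D = 1\<^sub>m n"
    using det_non_zero_imp_unit[OF D, of "()"] by (auto simp: Units_def ring_mat_simps)
  have "0 \<le> C $$ (i, k)" if i: "i < n" and k: "k < n" for i k
  proof -
    have col: "?D *\<^sub>v col C k = unit_vec n k"
      using C k D by (metis col_mult2 col_one)
    have "0 \<le> col C k $ i"
      by (rule nonneg[OF _ _ i]) (use C(1) k in \<open>auto simp: col unit_vec_def\<close>)
    then show ?thesis using C(1) i k by simp
  qed
  then have "0\<^sub>m n n \<le> C" using C(1) by (auto simp: less_eq_mat_def)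
  moreover have "inverts_mat ?D C" "inverts_mat C ?D" using C D by (auto simp: inverts_mat_def)
  ultimately show ?thesis using rho C(1) unfolding A_def by blast
qed

end
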